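(* Let $\alpha\in[0,1)$ and $\beta=1-\alpha$. Let $F:\bar\Gamma\to\mathbb{R}$ and $\Psi:\mathbb{R}^N\to\mathbb{R}$ be two bounded Borel functions such that $\Psi\le F$ in $\bar\Gamma$. Then there exists a unique bounded Borel function $u:X\to\mathbb{R}$ which satisfies $$u(x)=\begin{cases}\displaystyle \max\Big\{\Psi(x),\ \frac{\alpha}{2}\sup_{B_\epsilon(x)}u+\frac{\alpha}{2}\inf_{B_\epsilon(x)}u+\beta\,\frac{1}{|B_\epsilon(x)|}\int_{B_\epsilon(x)}u(y)\,dy\Big\} & \text{for } x\in\Omega,\\[2mm] F(x) & \text{for } x\in\Gamma.\end{cases}$$
   Context: $\Omega\subset\mathbb{R}^N$ is an open, bounded set with Lipschitz boundary. A small constant $0<\epsilon_0\ll1$ is fixed, and $\Gamma=\{x\in\mathbb{R}^N\setminus\Omega:\ \mathrm{dist}(x,\Omega)<\epsilon_0\}$, $X=\Omega\cup\Gamma$. The scale $\epsilon$ is fixed with $0<\epsilon\le\epsilon_0$. $B_\epsilon(x)$ is the open ball of radius $\epsilon$ centered at $x$ (so $B_\epsilon(x)\subset X$ for $x\in\Omega$), and $|B_\epsilon(x)|$ is its Lebesgue measure. *)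

theory Defs
  imports "HOL-Analysis.Analysis"
begin

text \<open>Near every boundary point the set is the strict epigraph of a Lipschitz function over the
  hyperplane orthogonal to some unit vector \<open>e\<close>. Choosing \<open>e\<close> replaces the usual
  ``after rotating and relabelling the coordinate axes''.\<close>

definition lipschitz_boundary :: "'a::euclidean_space set \<Rightarrow> bool" where
  "lipschitz_boundary \<Omega> \<longleftrightarrow>
     (\<forall>p \<in> frontier \<Omega>. \<exists>r>0. \<exists>e. norm e = 1 \<and>
        (\<exists>\<phi> L. L-lipschitz_on {z. z \<bullet> e = 0} \<phi> \<and>
           \<Omega> \<inter> ball p r =
             {y \<in> ball p r. (\<phi> (y - (y \<bullet> e) *\<^sub>R e) :: real) < y \<bullet> e}))"

definition outer_strip :: "'a::euclidean_space set \<Rightarrow> real \<Rightarrow> 'a set" where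
  "outer_strip \<Omega> \<epsilon>0 = {x. x \<notin> \<Omega> \<and> infdist x \<Omega> < \<epsilon>0}"

definition bounded_borel_on :: "'a::euclidean_space set \<Rightarrow> ('a \<Rightarrow> real) \<Rightarrow> bool" where
  "bounded_borel_on S f \<longleftrightarrow>
     f \<in> borel_measurable (restrict_space borel S) \<and> bounded (f ` S)"

definition ball_average :: "real \<Rightarrow> ('a::euclidean_space \<Rightarrow> real) \<Rightarrow> 'a \<Rightarrow> real" where
  "ball_average \<epsilon> u x =
     1 / measure lborel (ball x \<epsilon>) * (LINT y:ball x \<epsilon>|lborel. u y)"

end

theory Submission
  imports Defs
begin

text \<open>
  The solutions are the fixed points of the operator that sends \<open>u\<close> to the right-hand side of the
  equation. For the supremum norm this operator is in general only nonexpansive: a difference of two functions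
  that is constant on a ball can be passed on undiminished by the two extrema and by the average. What
  saves the argument is that the boundary values are kept and that the average has weight
  \<open>1 - \<alpha> > 0\<close>: information enters from the outside, at a definite rate. This is made quantitative by
  a weight \<open>\<phi>\<close>, pinched between two positive constants, with
  \<open>\<alpha> sup \<phi> + (1 - \<alpha>) avg \<phi> \<le> c \<phi>\<close> on \<open>\<Omega>\<close> for some \<open>c < 1\<close> (lemma
  \<open>strict_supersolution_exists\<close>). The difference of the right-hand sides for \<open>u\<close> and \<open>v\<close> at a point of
  \<open>\<Omega>\<close> is at most \<open>\<alpha> sup |u - v| + (1 - \<alpha>) avg |u - v|\<close>, so the operator contracts the norm
  \<open>sup |u| / \<phi>\<close> by the factor \<open>c\<close>, and Banach's fixed point argument yields existence and uniqueness
  together (lemma \<open>weighted_contraction_unique_fixpoint\<close>).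

  The weight is \<open>2 B - min B (exp (l (y \<bullet> e + R)))\<close> for a unit vector \<open>e\<close> and a large rate \<open>l\<close>. It is
  nowhere above \<open>2 B\<close>, which controls the supremum, while on the part of the ball \<open>B\<^sub>\<epsilon>(x)\<close> that lies
  farther than \<open>\<epsilon> / 2\<close> in direction \<open>e\<close> the exponential has grown by the factor \<open>exp (l \<epsilon> / 2)\<close>. That
  part fills at least a fixed fraction of the ball, so for large \<open>l\<close> the average alone pulls the mean of \<open>\<phi>\<close>
  down to \<open>\<phi> x - 1\<close> or less.

  The operator stays within the Borel functions because suprema over open balls of radius \<open>\<epsilon>\<close> are
  lower semicontinuous in the centre, infima are upper semicontinuous, and averages are parameter
  integrals.
\<close>

section \<open>Contractions in a weighted supremum norm\<close>

text \<open>
  Banach's fixed point theorem for the norm \<open>sup |u| / \<phi>\<close>, with the contraction property written as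
  the propagation of a bound \<open>|u - v| \<le> K \<phi>\<close>. Since \<open>\<phi>\<close> is bounded above and away from zero,
  convergence in this norm is uniform convergence. Functions are normalised outside \<open>X\<close> so that
  agreement on \<open>X\<close> is equality.
\<close>

lemma weighted_contraction_unique_fixpoint:
  fixes T :: "('a \<Rightarrow> real) \<Rightarrow> 'a \<Rightarrow> real" and \<phi> :: "'a \<Rightarrow> real"
  assumes ne: "V \<noteq> {}"
    and ext: "V \<subseteq> extensional X"
    and bdd: "\<And>u. u \<in> V \<Longrightarrow> bounded (u ` X)"
    and maps: "\<And>u. u \<in> V \<Longrightarrow> T u \<in> V"
    and closed: "\<And>f g. \<lbrakk>\<And>n. f n \<in> V; g \<in> extensional X; uniform_limit X f g sequentially\<rbrakk> \<Longrightarrow> g \<in> V"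
    and m: "0 < m" "\<And>x. x \<in> X \<Longrightarrow> m \<le> \<phi> x" "\<And>x. x \<in> X \<Longrightarrow> \<phi> x \<le> A"
    and c: "0 \<le> c" "c < 1"
    and contr: "\<And>u v K. \<lbrakk>u \<in> V; v \<in> V; 0 \<le> K; \<And>x. x \<in> X \<Longrightarrow> \<bar>u x - v x\<bar> \<le> K * \<phi> x\<rbrakk>
                 \<Longrightarrow> \<forall>x\<in>X. \<bar>T u x - T v x\<bar> \<le> c * K * \<phi> x"
  shows "\<exists>!u. u \<in> V \<and> T u = u"
proof -
  have weighted_bound: "\<exists>K\<ge>0. \<forall>x\<in>X. \<bar>u x - v x\<bar> \<le> K * \<phi> x" if uv: "u \<in> V" "v \<in> V" for u v
  proof -
    obtain a b where a: "\<forall>x\<in>X. \<bar>u x\<bar> \<le> a" and b: "\<forall>x\<in>X. \<bar>v x\<bar> \<le> b"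
      using bdd[OF uv(1)] bdd[OF uv(2)] by (auto simp: bounded_iff)
    define K where "K = (\<bar>a\<bar> + \<bar>b\<bar>) / m"
    have "K \<ge> 0" using m(1) by (simp add: K_def)
    moreover have "\<bar>u x - v x\<bar> \<le> K * \<phi> x" if "x \<in> X" for x
    proof -
      have "\<bar>u x - v x\<bar> \<le> K * m" using a b that m(1) by (force simp: K_def)
      also have "\<dots> \<le> K * \<phi> x" using m(2)[OF that] \<open>K \<ge> 0\<close> by (rule mult_left_mono)
      finally show ?thesis .
    qed
    ultimately show ?thesis by blast
  qed
  obtain u0 where u0: "u0 \<in> V" using ne by blast
  define U where "U n = (T ^^ n) u0" for n
  have UV: "U n \<in> V" for n by (induction n) (auto simp: U_def u0 maps)
  have U_Suc: "U (Suc n) = T (U n)" for n by (simp add: U_def)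
  obtain C where C: "C \<ge> 0" "\<forall>x\<in>X. \<bar>U 1 x - U 0 x\<bar> \<le> C * \<phi> x"
    using weighted_bound[OF UV UV] by blast
  have step: "\<forall>x\<in>X. \<bar>U (Suc n) x - U n x\<bar> \<le> (C * c ^ n) * \<phi> x" for n
  proof (induction n)
    case 0
    then show ?case using C by simp
  next
    case (Suc n)
    have "\<forall>x\<in>X. \<bar>T (U (Suc n)) x - T (U n) x\<bar> \<le> c * (C * c ^ n) * \<phi> x"
      by (rule contr) (use UV C c Suc in auto)
    then show ?case by (simp add: U_Suc mult_ac)
  qed
  have "uniform_limit X (\<lambda>n x. \<Sum>i<n. U (Suc i) x - U i x)
          (\<lambda>x. \<Sum>i. U (Suc i) x - U i x) sequentially"
  proof (rule Weierstrass_m_test)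
    show "norm (U (Suc n) x - U n x) \<le> (C * A) * c ^ n" if "x \<in> X" for n x
    proof -
      have "\<bar>U (Suc n) x - U n x\<bar> \<le> (C * c ^ n) * \<phi> x" using step that by blast
      also have "\<dots> \<le> (C * c ^ n) * A"
        using m(3)[OF that] C(1) c by (intro mult_left_mono) auto
      finally show ?thesis by (simp add: mult_ac)
    qed
    show "summable (\<lambda>n. (C * A) * c ^ n)"
      using c by (intro summable_mult summable_geometric) auto
  qed
  moreover have "(\<Sum>i<n. U (Suc i) x - U i x) = U n x - U 0 x" for n x
    by (rule sum_lessThan_telescope)
  ultimately have "uniform_limit X (\<lambda>n x. U n x - U 0 x)
          (\<lambda>x. \<Sum>i. U (Suc i) x - U i x) sequentially"
    by (simp only:)
  then have "uniform_limit X (\<lambda>n x. U 0 x + (U n x - U 0 x))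
          (\<lambda>x. U 0 x + (\<Sum>i. U (Suc i) x - U i x)) sequentially"
    by (intro uniform_limit_add uniform_limit_const) auto
  then have lim0: "uniform_limit X U (\<lambda>x. U 0 x + (\<Sum>i. U (Suc i) x - U i x)) sequentially"
    by (simp add: fun_eq_iff)
  define g where "g = restrict (\<lambda>x. U 0 x + (\<Sum>i. U (Suc i) x - U i x)) X"
  have lim: "uniform_limit X U g sequentially"
    using lim0 by (rule uniform_limit_cong'[THEN iffD1, rotated -1]) (auto simp: g_def)
  have gV: "g \<in> V" by (rule closed[OF UV _ lim]) (simp add: g_def)
  have "T g x = g x" if x: "x \<in> X" for x
  proof (rule LIMSEQ_unique)
    show "(\<lambda>n. U (Suc n) x) \<longlonglongrightarrow> g x"
      using tendsto_uniform_limitI[OF lim x] by (rule LIMSEQ_Suc)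
    show "(\<lambda>n. U (Suc n) x) \<longlonglongrightarrow> T g x"
    proof (rule tendstoI)
      fix e :: real assume e: "e > 0"
      have A: "0 < A" using m(1) m(2,3)[OF x] by linarith
      \<comment> \<open>An unweighted error \<open>d\<close> is at most \<open>(d / m) \<phi>\<close> and turns back into an unweighted error
        of at most \<open>(d / m) A = e\<close>.\<close>
      define d where "d = e * m / A"
      have d: "d > 0" using e A m by (simp add: d_def)
      have "\<forall>\<^sub>F n in sequentially. \<forall>x\<in>X. dist (U n x) (g x) < d"
        using lim d by (rule uniform_limitD)
      then show "\<forall>\<^sub>F n in sequentially. dist (U (Suc n) x) (T g x) < e"
      proof (rule eventually_mono)
        fix n assume n: "\<forall>x\<in>X. dist (U n x) (g x) < d"
        have "\<bar>U n y - g y\<bar> \<le> d / m * \<phi> y" if "y \<in> X" for y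
        proof -
          have "\<bar>U n y - g y\<bar> \<le> d / m * m" using n that m by (force simp: dist_real_def)
          also have "\<dots> \<le> d / m * \<phi> y" using m d that by (intro mult_left_mono) auto
          finally show ?thesis .
        qed
        then have "\<forall>x\<in>X. \<bar>T (U n) x - T g x\<bar> \<le> c * (d / m) * \<phi> x"
          using d m by (intro contr UV gV) auto
        then have "\<bar>U (Suc n) x - T g x\<bar> \<le> c * (d / m) * \<phi> x" using x by (simp add: U_Suc)
        also have "\<dots> \<le> c * (d / m) * A"
          using m(3)[OF x] c d m by (intro mult_left_mono) auto
        also have "\<dots> = c * e" using A m by (simp add: d_def)
        also have "\<dots> < e" using c e by simp
        finally show "dist (U (Suc n) x) (T g x) < e" by (simp add: dist_real_def)
      qed
    qed
  qed
  then have Tg: "T g = g"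
    using ext gV maps[OF gV] by (intro extensionalityI[of _ X]) auto
  have uniq: "u = v" if uv: "u \<in> V" "v \<in> V" "T u = u" "T v = v" for u v
  proof (rule extensionalityI[of _ X])
    show "u \<in> extensional X" "v \<in> extensional X" using ext uv by auto
    fix x assume x: "x \<in> X"
    obtain K where K: "K \<ge> 0" "\<forall>x\<in>X. \<bar>u x - v x\<bar> \<le> K * \<phi> x"
      using weighted_bound uv by blast
    have iter: "\<forall>x\<in>X. \<bar>u x - v x\<bar> \<le> (c ^ n * K) * \<phi> x" for n
    proof (induction n)
      case (Suc n)
      have "\<forall>x\<in>X. \<bar>T u x - T v x\<bar> \<le> c * (c ^ n * K) * \<phi> x"
        by (rule contr) (use uv K c Suc in auto)
      then show ?case using uv by (simp add: mult_ac)
    qed (use K in simp)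
    have "(\<lambda>n. (c ^ n * K) * \<phi> x) \<longlonglongrightarrow> (0 * K) * \<phi> x"
      using c by (intro tendsto_intros LIMSEQ_realpow_zero)
    then have "\<bar>u x - v x\<bar> \<le> (0 * K) * \<phi> x"
      by (rule LIMSEQ_le_const) (use iter x in auto)
    then show "u x = v x" by simp
  qed
  show ?thesis using gV Tg uniq by blast
qed

section \<open>Bounded Borel functions\<close>

lemma bounded_borel_on_UNIV_iff:
  "bounded_borel_on UNIV u \<longleftrightarrow> u \<in> borel_measurable borel \<and> bounded (range u)"
  using measurable_restrict_space_iff[of UNIV borel 0 borel u] by (simp add: bounded_borel_on_def)

lemma bounded_borel_on_UNIV_bound:
  assumes "bounded_borel_on UNIV u"
  obtains C where "\<And>x. \<bar>u x\<bar> \<le> C"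
proof -
  obtain C where "\<forall>y\<in>range u. norm y \<le> C"
    using assms unfolding bounded_borel_on_def bounded_iff by blast
  then have "\<bar>u x\<bar> \<le> C" for x by simp
  then show thesis by (rule that)
qed

text \<open>
  Extension by zero reduces measurability on a subset to measurability on the whole space, where
  the mean can be taken over balls with arbitrary centre.
\<close>

lemma bounded_borel_on_iff_extension:
  assumes "X \<in> sets borel"
  shows "bounded_borel_on X u \<longleftrightarrow> bounded_borel_on UNIV (\<lambda>x. if x \<in> X then u x else 0)"
proof -
  have "bounded (u ` X) \<longleftrightarrow> bounded (range (\<lambda>x. if x \<in> X then u x else 0))"
  proof
    assume "bounded (u ` X)"
    then have "bounded (insert 0 (u ` X))" by simp
    then show "bounded (range (\<lambda>x. if x \<in> X then u x else 0))"
      by (rule bounded_subset) auto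
  next
    assume "bounded (range (\<lambda>x. if x \<in> X then u x else 0))"
    then show "bounded (u ` X)" by (rule bounded_subset) (auto split: if_splits)
  qed
  moreover have "u \<in> borel_measurable (restrict_space borel X)
      \<longleftrightarrow> (\<lambda>x. if x \<in> X then u x else 0) \<in> borel_measurable borel"
    using assms by (intro measurable_restrict_space_iff) auto
  ultimately show ?thesis
    unfolding bounded_borel_on_UNIV_iff unfolding bounded_borel_on_def by (simp only:)
qed

lemma bounded_borel_on_subset:
  assumes u: "bounded_borel_on X u" and S: "S \<subseteq> X"
  shows "bounded_borel_on S u"
  unfolding bounded_borel_on_def
proof
  have "u \<in> borel_measurable (restrict_space borel X)"
    using u by (simp only: bounded_borel_on_def)
  then have "u \<in> borel_measurable (restrict_space (restrict_space borel X) S)"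
    by (rule measurable_restrict_space1)
  moreover have "sets (restrict_space (restrict_space borel X) S) = sets (restrict_space borel S)"
    using S by (simp add: sets_restrict_restrict_space Int_absorb1)
  ultimately show "u \<in> borel_measurable (restrict_space borel S)"
    using measurable_cong_sets[OF _ refl] by (metis (no_types))
  show "bounded (u ` S)"
    using u unfolding bounded_borel_on_def by (elim conjE bounded_subset) (rule image_mono[OF S])
qed

lemma bounded_borel_on_uniform_limit:
  assumes f: "\<And>n. bounded_borel_on X (f n)" and lim: "uniform_limit X f g sequentially"
  shows "bounded_borel_on X g"
  unfolding bounded_borel_on_def
proof
  show "g \<in> borel_measurable (restrict_space borel X)"
  proof (rule borel_measurable_LIMSEQ_real)
    show "f n \<in> borel_measurable (restrict_space borel X)" for n
      using f[of n] by (simp add: bounded_borel_on_def)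
    show "(\<lambda>n. f n x) \<longlonglongrightarrow> g x" if "x \<in> space (restrict_space borel X)" for x
      using tendsto_uniform_limitI[OF lim] that by (simp add: space_restrict_space)
  qed
  have "\<forall>\<^sub>F n in sequentially. \<forall>x\<in>X. dist (f n x) (g x) < 1"
    by (rule uniform_limitD[OF lim]) simp
  then obtain n where n: "\<forall>x\<in>X. dist (f n x) (g x) < 1"
    using eventually_happens'[OF sequentially_bot] by blast
  obtain B where B: "\<forall>y\<in>f n ` X. norm y \<le> B"
    using f[of n] unfolding bounded_borel_on_def bounded_iff by blast
  have "norm (g x) \<le> B + 1" if "x \<in> X" for x
  proof -
    have "\<bar>f n x\<bar> \<le> B" "\<bar>f n x - g x\<bar> < 1" using B n that by (auto simp: dist_real_def)
    then show ?thesis unfolding real_norm_def by linarith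
  qed
  then show "bounded (g ` X)" by (intro boundedI) auto
qed

lemma bounded_borel_on_ball_integrable:
  assumes "bounded_borel_on (ball x \<epsilon>) u"
  shows "set_integrable lborel (ball x \<epsilon>) u"
proof -
  let ?u = "\<lambda>y. if y \<in> ball x \<epsilon> then u y else 0"
  have u: "bounded_borel_on UNIV ?u"
    using assms bounded_borel_on_iff_extension[of "ball x \<epsilon>" u] by simp
  then obtain B where B: "\<And>y. \<bar>?u y\<bar> \<le> B"
    by (rule bounded_borel_on_UNIV_bound) (rule that)
  have u_le: "\<bar>u y\<bar> \<le> B" if "y \<in> ball x \<epsilon>" for y
    using B[of y] that by simp
  have "?u \<in> borel_measurable borel"
    using u by (simp add: bounded_borel_on_UNIV_iff)
  then have "integrable lborel (\<lambda>y. indicator (ball x \<epsilon>) y *\<^sub>R ?u y)"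
    using u_le by (intro integrableI_bounded_set_indicator[where B=B] emeasure_lborel_ball_finite AE_I2)
      auto
  also have "(\<lambda>y. indicator (ball x \<epsilon>) y *\<^sub>R ?u y) = (\<lambda>y. indicator (ball x \<epsilon>) y *\<^sub>R u y)"
    by (auto simp: indicator_def)
  finally show ?thesis unfolding set_integrable_def .
qed

lemma continuous_bounded_borel_on:
  fixes u :: "'a::euclidean_space \<Rightarrow> real"
  assumes "continuous_on UNIV u" "bounded (range u)"
  shows "bounded_borel_on S u"
proof (rule bounded_borel_on_subset)
  show "bounded_borel_on UNIV u"
    unfolding bounded_borel_on_UNIV_iff
    using borel_measurable_continuous_onI[OF assms(1)] assms(2) by (rule conjI)
qed simp

section \<open>The tug-of-war mean\<close>

definition tug_mean :: "real \<Rightarrow> real \<Rightarrow> ('a::euclidean_space \<Rightarrow> real) \<Rightarrow> 'a \<Rightarrow> real" where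
  "tug_mean \<alpha> \<epsilon> u x = \<alpha> / 2 * (SUP y \<in> ball x \<epsilon>. u y) + \<alpha> / 2 * (INF y \<in> ball x \<epsilon>. u y)
     + (1 - \<alpha>) * ball_average \<epsilon> u x"

text \<open>
  The sublinear mean that dominates differences of tug-of-war means: both the difference of suprema
  and that of infima are bounded by the supremum of the difference, whence the single weight \<open>\<alpha>\<close>.
\<close>

definition upper_mean :: "real \<Rightarrow> real \<Rightarrow> ('a::euclidean_space \<Rightarrow> real) \<Rightarrow> 'a \<Rightarrow> real" where
  "upper_mean \<alpha> \<epsilon> w x = \<alpha> * (SUP y \<in> ball x \<epsilon>. w y) + (1 - \<alpha>) * ball_average \<epsilon> w x"

lemma tug_mean_cong:
  assumes "\<And>y. y \<in> ball x \<epsilon> \<Longrightarrow> u y = v y"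
  shows "tug_mean \<alpha> \<epsilon> u x = tug_mean \<alpha> \<epsilon> v x"
proof -
  have "u ` ball x \<epsilon> = v ` ball x \<epsilon>" using assms by (rule image_cong[OF refl])
  moreover have "(LINT y:ball x \<epsilon>|lborel. u y) = (LINT y:ball x \<epsilon>|lborel. v y)"
    by (rule set_lebesgue_integral_cong) (use assms in auto)
  ultimately show ?thesis by (simp only: tug_mean_def ball_average_def)
qed

lemma ball_average_mono:
  assumes "bounded_borel_on (ball x \<epsilon>) u" "bounded_borel_on (ball x \<epsilon>) v"
    and "\<And>y. y \<in> ball x \<epsilon> \<Longrightarrow> u y \<le> v y"
  shows "ball_average \<epsilon> u x \<le> ball_average \<epsilon> v x"
proof -
  have "(LINT y:ball x \<epsilon>|lborel. u y) \<le> (LINT y:ball x \<epsilon>|lborel. v y)"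
    using assms by (intro set_integral_mono bounded_borel_on_ball_integrable)
  then show ?thesis unfolding ball_average_def by (rule mult_left_mono) simp
qed

lemma ball_average_add_mult:
  assumes "bounded_borel_on (ball x \<epsilon>) u" "bounded_borel_on (ball x \<epsilon>) v"
  shows "ball_average \<epsilon> (\<lambda>y. u y + K * v y) x = ball_average \<epsilon> u x + K * ball_average \<epsilon> v x"
proof -
  have "set_integrable lborel (ball x \<epsilon>) u" "set_integrable lborel (ball x \<epsilon>) (\<lambda>y. K * v y)"
    by (auto intro: bounded_borel_on_ball_integrable assms)
  then have "(LINT y:ball x \<epsilon>|lborel. u y + K * v y)
      = (LINT y:ball x \<epsilon>|lborel. u y) + (LINT y:ball x \<epsilon>|lborel. K * v y)"
    by (rule set_integral_add)
  also have "(LINT y:ball x \<epsilon>|lborel. K * v y) = K * (LINT y:ball x \<epsilon>|lborel. v y)"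
    by (rule set_integral_mult_right)
  finally show ?thesis by (simp add: ball_average_def ring_distribs)
qed

lemma bounded_borel_on_add_mult:
  assumes "bounded_borel_on S u" "bounded_borel_on S v"
  shows "bounded_borel_on S (\<lambda>y. u y + K * v y)"
  unfolding bounded_borel_on_def
proof
  have "bounded ((\<lambda>y. u y + K *\<^sub>R v y) ` S)"
    by (intro bounded_plus_comp bounded_scaleR_comp)
      (use assms in \<open>simp_all add: bounded_borel_on_def\<close>)
  then show "bounded ((\<lambda>y. u y + K * v y) ` S)" by simp
  show "(\<lambda>y. u y + K * v y) \<in> borel_measurable (restrict_space borel S)"
    by (intro borel_measurable_add borel_measurable_times borel_measurable_const)
      (use assms in \<open>simp_all add: bounded_borel_on_def\<close>)
qed

lemma tug_mean_comparison:
  assumes \<alpha>: "0 \<le> \<alpha>" "\<alpha> \<le> 1" and \<epsilon>: "0 < \<epsilon>" and K: "0 \<le> K"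
    and u: "bounded_borel_on (ball x \<epsilon>) u" and v: "bounded_borel_on (ball x \<epsilon>) v"
    and w: "bounded_borel_on (ball x \<epsilon>) w"
    and le: "\<And>y. y \<in> ball x \<epsilon> \<Longrightarrow> u y \<le> v y + K * w y"
  shows "tug_mean \<alpha> \<epsilon> u x \<le> tug_mean \<alpha> \<epsilon> v x + K * upper_mean \<alpha> \<epsilon> w x"
proof -
  let ?B = "ball x \<epsilon>" and ?S = "SUP y\<in>ball x \<epsilon>. w y"
  have ne: "?B \<noteq> {}" using \<epsilon> by simp
  have bdd: "bdd_above (f ` ?B)" "bdd_below (f ` ?B)" if "bounded_borel_on ?B f" for f
    using that by (auto simp: bounded_borel_on_def intro: bounded_imp_bdd_above bounded_imp_bdd_below)
  have wS: "u y \<le> v y + K * ?S" if "y \<in> ?B" for y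
  proof -
    have "K * w y \<le> K * ?S"
      using that K bdd[OF w] by (intro mult_left_mono cSUP_upper) auto
    then show ?thesis using le[OF that] by linarith
  qed
  have sup: "(SUP y\<in>?B. u y) \<le> (SUP y\<in>?B. v y) + K * ?S"
  proof (rule cSUP_least[OF ne])
    fix y assume y: "y \<in> ?B"
    then have "v y \<le> (SUP y\<in>?B. v y)" using bdd[OF v] by (intro cSUP_upper) auto
    then show "u y \<le> (SUP y\<in>?B. v y) + K * ?S" using wS[OF y] by linarith
  qed
  have "(INF y\<in>?B. u y) - K * ?S \<le> (INF y\<in>?B. v y)"
  proof (rule cINF_greatest[OF ne])
    fix y assume y: "y \<in> ?B"
    then have "(INF y\<in>?B. u y) \<le> u y" using bdd[OF u] by (intro cINF_lower) auto
    then show "(INF y\<in>?B. u y) - K * ?S \<le> v y" using wS[OF y] by linarith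
  qed
  then have inf: "(INF y\<in>?B. u y) \<le> (INF y\<in>?B. v y) + K * ?S" by linarith
  have "ball_average \<epsilon> u x \<le> ball_average \<epsilon> (\<lambda>y. v y + K * w y) x"
    using u v w le by (intro ball_average_mono bounded_borel_on_add_mult)
  then have avg: "ball_average \<epsilon> u x \<le> ball_average \<epsilon> v x + K * ball_average \<epsilon> w x"
    using ball_average_add_mult[OF v w] by simp
  have "tug_mean \<alpha> \<epsilon> u x \<le> \<alpha> / 2 * ((SUP y\<in>?B. v y) + K * ?S)
      + \<alpha> / 2 * ((INF y\<in>?B. v y) + K * ?S) + (1 - \<alpha>) * (ball_average \<epsilon> v x + K * ball_average \<epsilon> w x)"
    unfolding tug_mean_def using \<alpha> sup inf avg by (intro add_mono mult_left_mono) auto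
  also have "\<dots> = tug_mean \<alpha> \<epsilon> v x + K * upper_mean \<alpha> \<epsilon> w x"
    by (simp add: tug_mean_def upper_mean_def algebra_simps)
  finally show ?thesis .
qed

lemma tug_mean_abs_diff_le:
  assumes \<alpha>: "0 \<le> \<alpha>" "\<alpha> \<le> 1" and \<epsilon>: "0 < \<epsilon>" and K: "0 \<le> K"
    and u: "bounded_borel_on (ball x \<epsilon>) u" and v: "bounded_borel_on (ball x \<epsilon>) v"
    and w: "bounded_borel_on (ball x \<epsilon>) w"
    and le: "\<And>y. y \<in> ball x \<epsilon> \<Longrightarrow> \<bar>u y - v y\<bar> \<le> K * w y"
  shows "\<bar>tug_mean \<alpha> \<epsilon> u x - tug_mean \<alpha> \<epsilon> v x\<bar> \<le> K * upper_mean \<alpha> \<epsilon> w x"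
proof -
  have "u y \<le> v y + K * w y" "v y \<le> u y + K * w y" if "y \<in> ball x \<epsilon>" for y
    using le[OF that] by linarith+
  then have "tug_mean \<alpha> \<epsilon> u x \<le> tug_mean \<alpha> \<epsilon> v x + K * upper_mean \<alpha> \<epsilon> w x"
    "tug_mean \<alpha> \<epsilon> v x \<le> tug_mean \<alpha> \<epsilon> u x + K * upper_mean \<alpha> \<epsilon> w x"
    using tug_mean_comparison[OF \<alpha> \<epsilon> K u v w] tug_mean_comparison[OF \<alpha> \<epsilon> K v u w] by auto
  then show ?thesis by linarith
qed

lemma ball_average_const:
  assumes "0 < \<epsilon>"
  shows "ball_average \<epsilon> (\<lambda>_. c) x = c"
proof -
  have "0 < measure lborel (ball x \<epsilon>)" using assms by (simp add: content_ball_pos)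
  then show ?thesis
    by (simp add: ball_average_def set_lebesgue_integral_def)
qed

text \<open>Comparison of \<open>u\<close> with the zero function, whose mean vanishes.\<close>

lemma tug_mean_bounded:
  assumes \<alpha>: "0 \<le> \<alpha>" "\<alpha> \<le> 1" and \<epsilon>: "0 < \<epsilon>"
    and u: "bounded_borel_on (ball x \<epsilon>) u"
    and C: "\<And>y. y \<in> ball x \<epsilon> \<Longrightarrow> \<bar>u y\<bar> \<le> C"
  shows "\<bar>tug_mean \<alpha> \<epsilon> u x\<bar> \<le> C"
proof -
  have const: "bounded_borel_on (ball x \<epsilon>) (\<lambda>_. c)" for c
    by (rule continuous_bounded_borel_on) auto
  have "0 \<le> C" using C[of x] \<epsilon> by auto
  then have "\<bar>tug_mean \<alpha> \<epsilon> u x - tug_mean \<alpha> \<epsilon> (\<lambda>_. 0) x\<bar> \<le> C * upper_mean \<alpha> \<epsilon> (\<lambda>_. 1) x"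
    using C by (intro tug_mean_abs_diff_le \<alpha> \<epsilon> u const) auto
  then show ?thesis
    using \<epsilon> by (simp add: tug_mean_def upper_mean_def ball_average_const)
qed

text \<open>
  The supremum exceeds \<open>a\<close> at \<open>x\<close> iff some \<open>y\<close> with \<open>u y > a\<close> is within distance \<open>\<epsilon>\<close> of \<open>x\<close>, so the
  superlevel sets are unions of open balls.
\<close>

lemma borel_measurable_SUP_ball:
  fixes u :: "'a::euclidean_space \<Rightarrow> real"
  assumes \<epsilon>: "0 < \<epsilon>" and u: "bounded (range u)"
  shows "(\<lambda>x. SUP y\<in>ball x \<epsilon>. u y) \<in> borel_measurable borel"
  unfolding borel_measurable_iff_greater
proof
  fix a
  have "a < (SUP y\<in>ball x \<epsilon>. u y) \<longleftrightarrow> (\<exists>y\<in>ball x \<epsilon>. a < u y)" for x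
    using \<epsilon> u by (intro less_cSUP_iff) (auto intro!: bounded_imp_bdd_above intro: bounded_subset)
  then have "{x. a < (SUP y\<in>ball x \<epsilon>. u y)} = (\<Union>y\<in>{y. a < u y}. ball y \<epsilon>)"
    by (auto simp: dist_commute)
  then show "{x \<in> space borel. a < (SUP y\<in>ball x \<epsilon>. u y)} \<in> sets borel" by (simp add: open_UN)
qed

lemma borel_measurable_INF_ball:
  fixes u :: "'a::euclidean_space \<Rightarrow> real"
  assumes \<epsilon>: "0 < \<epsilon>" and u: "bounded (range u)"
  shows "(\<lambda>x. INF y\<in>ball x \<epsilon>. u y) \<in> borel_measurable borel"
proof -
  have "bounded (range (\<lambda>y. - u y))" using u by (simp add: bounded_iff)
  then have "(\<lambda>x. - (SUP y\<in>ball x \<epsilon>. - u y)) \<in> borel_measurable borel"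
    by (intro borel_measurable_uminus borel_measurable_SUP_ball \<epsilon>)
  then show ?thesis by (simp add: Inf_real_def image_image)
qed

text \<open>
  The volume of the ball does not depend on its centre, and the integrand, written with
  \<open>dist x y < \<epsilon>\<close>, is jointly measurable in the centre and the point.
\<close>

lemma borel_measurable_ball_average:
  fixes u :: "'a::euclidean_space \<Rightarrow> real"
  assumes [measurable]: "u \<in> borel_measurable borel"
  shows "ball_average \<epsilon> u \<in> borel_measurable borel"
proof -
  have [measurable]: "(\<lambda>x::'a. LINT y|lborel. (if dist x y < \<epsilon> then u y else 0)) \<in> borel_measurable borel"
    by (rule lborel.borel_measurable_lebesgue_integral) measurable
  have integral: "(LINT y:ball x \<epsilon>|lborel. u y) = (LINT y|lborel. (if dist x y < \<epsilon> then u y else 0))" for x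
    unfolding set_lebesgue_integral_def
    by (rule Bochner_Integration.integral_cong) (auto simp: indicator_def)
  have volume: "measure lborel (ball x \<epsilon>) = measure lborel (ball (0::'a) \<epsilon>)" for x :: 'a
    by (cases "\<epsilon> \<ge> 0") (auto simp: content_ball ball_empty)
  have "ball_average \<epsilon> u =
      (\<lambda>x. 1 / measure lborel (ball (0::'a) \<epsilon>) * (LINT y|lborel. (if dist x y < \<epsilon> then u y else 0)))"
    proof
    show "ball_average \<epsilon> u x = 1 / measure lborel (ball (0::'a) \<epsilon>) *
        (LINT y|lborel. (if dist x y < \<epsilon> then u y else 0))" for x
      unfolding ball_average_def integral by (subst volume) (rule refl)
  qed
  then show ?thesis by simp
qed

lemma borel_measurable_tug_mean:
  fixes u :: "'a::euclidean_space \<Rightarrow> real"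
  assumes "0 < \<epsilon>" "bounded_borel_on UNIV u"
  shows "tug_mean \<alpha> \<epsilon> u \<in> borel_measurable borel"
  using assms unfolding tug_mean_def[abs_def]
  by (intro borel_measurable_add borel_measurable_times borel_measurable_const
      borel_measurable_SUP_ball borel_measurable_INF_ball borel_measurable_ball_average)
     (auto simp: bounded_borel_on_UNIV_iff)

section \<open>A strict supersolution\<close>

text \<open>
  The ball of radius \<open>\<epsilon> / 4\<close> around \<open>x + (3 / 4) \<epsilon> e\<close> touches both the sphere of radius \<open>\<epsilon>\<close> around
  \<open>x\<close> and the hyperplane at height \<open>\<epsilon> / 2\<close> above \<open>x\<close>. On it the function has dropped by \<open>d\<close>, and it
  takes up the fraction \<open>(1 / 4) ^ DIM('a)\<close> of the large ball.
\<close>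

lemma ball_average_le_half_ball:
  fixes e :: "'a::euclidean_space"
  assumes \<epsilon>: "0 < \<epsilon>" and e: "norm e = 1" and d: "0 \<le> d"
    and \<phi>: "bounded_borel_on (ball x \<epsilon>) \<phi>"
    and upper: "\<And>y. y \<in> ball x \<epsilon> \<Longrightarrow> \<phi> y \<le> A"
    and half: "\<And>y. \<lbrakk>y \<in> ball x \<epsilon>; x \<bullet> e + \<epsilon> / 2 < y \<bullet> e\<rbrakk> \<Longrightarrow> \<phi> y \<le> A - d"
  shows "ball_average \<epsilon> \<phi> x \<le> A - (1 / 4) ^ DIM('a) * d"
proof -
  define z where "z = x + (3 / 4 * \<epsilon>) *\<^sub>R e"
  have xz: "dist x z = 3 / 4 * \<epsilon>" using \<epsilon> e by (simp add: z_def dist_norm)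
  have small: "ball z (\<epsilon> / 4) \<subseteq> ball x \<epsilon>"
  proof
    fix y assume "y \<in> ball z (\<epsilon> / 4)"
    then show "y \<in> ball x \<epsilon>" using xz dist_triangle[of x y z] by auto
  qed
  have beyond: "x \<bullet> e + \<epsilon> / 2 < y \<bullet> e" if "y \<in> ball z (\<epsilon> / 4)" for y
  proof -
    have "(z - y) \<bullet> e \<le> norm (z - y)"
      using norm_cauchy_schwarz[of "z - y" e] e by simp
    also have "\<dots> < \<epsilon> / 4" using that by (simp add: dist_norm)
    finally have "z \<bullet> e - y \<bullet> e < \<epsilon> / 4" by (simp add: inner_diff_left)
    moreover have "z \<bullet> e = x \<bullet> e + 3 / 4 * \<epsilon>"
      using e by (simp add: z_def inner_add_left dot_square_norm)
    ultimately show ?thesis by linarith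
  qed
  let ?i = "indicat_real (ball z (\<epsilon> / 4))"
  have const: "bounded_borel_on (ball x \<epsilon>) (\<lambda>_. A)"
    by (rule continuous_bounded_borel_on) auto
  have "bounded (range ?i)" by (rule boundedI[of _ 1]) (auto simp: indicator_def)
  moreover have "?i \<in> borel_measurable borel" by (rule borel_measurable_indicator) simp
  ultimately have "bounded_borel_on UNIV ?i"
    by (simp add: bounded_borel_on_UNIV_iff)
  then have ind: "bounded_borel_on (ball x \<epsilon>) ?i" by (rule bounded_borel_on_subset) simp
  have "ball_average \<epsilon> \<phi> x \<le> ball_average \<epsilon> (\<lambda>y. A + (- d) * ?i y) x"
  proof (rule ball_average_mono[OF \<phi>])
    show "bounded_borel_on (ball x \<epsilon>) (\<lambda>y. A + (- d) * ?i y)"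
      by (rule bounded_borel_on_add_mult[OF const ind])
    show "\<phi> y \<le> A + (- d) * ?i y" if "y \<in> ball x \<epsilon>" for y
      using upper[OF that] half[OF that] beyond[of y] by (auto simp: indicator_def)
  qed
  also have "\<dots> = A - d * ball_average \<epsilon> ?i x"
    using ball_average_add_mult[OF const ind, of "- d"] ball_average_const[OF \<epsilon>, of A x] by simp
  also have "ball_average \<epsilon> ?i x = measure lborel (ball z (\<epsilon> / 4)) / measure lborel (ball x \<epsilon>)"
  proof -
    have "(LINT y:ball x \<epsilon>|lborel. ?i y) = (LINT y|lborel. ?i y)"
      unfolding set_lebesgue_integral_def
      using small by (intro Bochner_Integration.integral_cong) (auto simp: indicator_def)
    then show ?thesis by (simp add: ball_average_def)
  qed
  also have "\<dots> = (1 / 4) ^ DIM('a)"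
    using \<epsilon> by (simp add: content_ball power_divide unit_ball_vol_pos[THEN less_imp_neq, symmetric])
  finally show ?thesis by (simp add: mult.commute)
qed

text \<open>
  The weight of the contraction argument. Cutting the exponential off at \<open>B\<close> keeps \<open>\<phi>\<close> between \<open>B\<close>
  and \<open>2 B\<close> on the whole space; \<open>B\<close> is chosen so large that the cut-off does not interfere with the
  gain at points of \<open>\<Omega>\<close>.
\<close>

lemma strict_supersolution_exists:
  fixes \<Omega> :: "'a::euclidean_space set"
  assumes \<Omega>: "bounded \<Omega>" and \<alpha>: "0 \<le> \<alpha>" "\<alpha> < 1" and \<epsilon>: "0 < \<epsilon>"
  obtains \<phi> :: "'a \<Rightarrow> real" and c m A where
    "bounded_borel_on UNIV \<phi>" "0 < m" "\<And>x. m \<le> \<phi> x" "\<And>x. \<phi> x \<le> A"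
    "0 \<le> c" "c < 1" "\<And>x. x \<in> \<Omega> \<Longrightarrow> upper_mean \<alpha> \<epsilon> \<phi> x \<le> c * \<phi> x"
proof -
  obtain e :: 'a where "e \<in> Basis" using nonempty_Basis by blast
  then have e: "norm e = 1" by simp
  obtain R where R: "0 < R" "\<forall>x\<in>\<Omega>. norm x \<le> R"
    using \<Omega> by (auto simp: bounded_pos)
  define p :: real where "p = (1 / 4) ^ DIM('a)"
  have p: "0 < p" "p \<le> 1" by (auto simp: p_def power_le_one)
  define q where "q = (1 - \<alpha>) * p"
  have q: "0 < q" "q \<le> 1" using \<alpha> p by (auto simp: q_def mult_le_one)
  \<comment> \<open>The rate is chosen so that the gain on the far part of the ball, weighted by its share \<open>q\<close> in
    the mean, is exactly twice the value of the exponential at the centre.\<close>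
  define l where "l = 2 / \<epsilon> * ln (2 / q)"
  have l: "0 \<le> l" using \<epsilon> q by (simp add: l_def)
  have gain: "q * exp (l * (\<epsilon> / 2)) = 2" using \<epsilon> q by (simp add: l_def)
  \<comment> \<open>For \<open>x\<close> in \<open>\<Omega>\<close> the exponent \<open>l (x \<bullet> e + R)\<close> lies between \<open>0\<close> and \<open>2 l R\<close>; the summand \<open>\<epsilon>\<close>
    leaves room for its growth within the ball.\<close>
  define B where "B = exp (l * (2 * R + \<epsilon>))"
  have B: "1 \<le> B" using l R \<epsilon> by (simp add: B_def)
  define \<phi> where "\<phi> y = 2 * B - min B (exp (l * (y \<bullet> e + R)))" for y
  have lower: "B \<le> \<phi> y" and upper: "\<phi> y \<le> 2 * B" for y
    using B by (auto simp: \<phi>_def)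
  have "bounded (range \<phi>)"
  proof (intro boundedI[of _ "2 * B"])
    show "norm z \<le> 2 * B" if "z \<in> range \<phi>" for z
      using that lower upper B by (smt (verit) imageE real_norm_def)
  qed
  moreover have "continuous_on UNIV \<phi>"
    unfolding \<phi>_def by (intro continuous_intros)
  ultimately have borel: "bounded_borel_on S \<phi>" for S
    by (intro continuous_bounded_borel_on)
  \<comment> \<open>A decrease by \<open>1\<close> is a decrease by at least the fraction \<open>1 / (2 B)\<close> of a value that is at most
    \<open>2 B\<close>.\<close>
  define c where "c = 1 - 1 / (2 * B)"
  have "upper_mean \<alpha> \<epsilon> \<phi> x \<le> c * \<phi> x" if x: "x \<in> \<Omega>" for x
  proof -
    define E where "E = exp (l * (x \<bullet> e + R))"
    have "\<bar>x \<bullet> e\<bar> \<le> norm x" using Cauchy_Schwarz_ineq2[of x e] e by simp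
    then have xe: "- R \<le> x \<bullet> e" "x \<bullet> e \<le> R" using R x by fastforce+
    have E: "1 \<le> E" using l xe by (simp add: E_def)
    have "E \<le> B" unfolding E_def B_def using l xe \<epsilon> by (auto intro!: mult_left_mono)
    then have \<phi>x: "\<phi> x = 2 * B - E" by (simp add: \<phi>_def E_def)
    define d where "d = exp (l * (\<epsilon> / 2)) * E"
    have d_eq: "d = exp (l * (x \<bullet> e + R + \<epsilon> / 2))"
      by (simp add: d_def E_def exp_add[symmetric] algebra_simps)
    have "(SUP y\<in>ball x \<epsilon>. \<phi> y) \<le> 2 * B" using \<epsilon> upper by (intro cSUP_least) auto
    moreover have "ball_average \<epsilon> \<phi> x \<le> 2 * B - p * d"
      unfolding p_def
    proof (rule ball_average_le_half_ball[OF \<epsilon> e _ borel])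
      show "0 \<le> d" by (simp add: d_eq)
      show "\<phi> y \<le> 2 * B" for y by (rule upper)
      show "\<phi> y \<le> 2 * B - d" if "x \<bullet> e + \<epsilon> / 2 < y \<bullet> e" for y
      proof -
        have "d \<le> B" unfolding d_eq B_def using l xe \<epsilon> by (auto intro!: mult_left_mono)
        moreover have "d \<le> exp (l * (y \<bullet> e + R))"
          unfolding d_eq using l that by (auto intro!: mult_left_mono)
        ultimately show ?thesis by (simp add: \<phi>_def)
      qed
    qed
    ultimately have "upper_mean \<alpha> \<epsilon> \<phi> x \<le> \<alpha> * (2 * B) + (1 - \<alpha>) * (2 * B - p * d)"
      unfolding upper_mean_def using \<alpha> by (intro add_mono mult_left_mono) auto
    also have "\<dots> = 2 * B - (q * exp (l * (\<epsilon> / 2))) * E"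
      by (simp add: q_def d_def algebra_simps)
    also have "\<dots> \<le> \<phi> x - 1" using E unfolding gain \<phi>x by simp
    also have "\<dots> \<le> c * \<phi> x" using upper[of x] B by (simp add: c_def field_simps)
    finally show ?thesis .
  qed
  moreover have "0 \<le> c" "c < 1" using B by (auto simp: c_def)
  moreover have "0 < B" using B by simp
  ultimately show thesis using that[of \<phi> B "2 * B" c] borel lower upper by blast
qed

section \<open>The obstacle problem\<close>

definition obstacle_operator ::
    "'a::euclidean_space set \<Rightarrow> 'a set \<Rightarrow> real \<Rightarrow> real \<Rightarrow> ('a \<Rightarrow> real) \<Rightarrow> ('a \<Rightarrow> real)
      \<Rightarrow> ('a \<Rightarrow> real) \<Rightarrow> 'a \<Rightarrow> real" where
  "obstacle_operator \<Omega> X \<alpha> \<epsilon> F \<Psi> u =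
     (\<lambda>x\<in>X. if x \<in> \<Omega> then max (\<Psi> x) (tug_mean \<alpha> \<epsilon> u x) else F x)"

lemma bounded_borel_on_obstacle_operator:
  assumes \<Omega>: "open \<Omega>" "\<Omega> \<subseteq> X" and X: "X \<in> sets borel"
    and balls: "\<And>x. x \<in> \<Omega> \<Longrightarrow> ball x \<epsilon> \<subseteq> X"
    and \<alpha>: "0 \<le> \<alpha>" "\<alpha> \<le> 1" and \<epsilon>: "0 < \<epsilon>"
    and F: "bounded_borel_on (X - \<Omega>) F" and \<Psi>: "bounded_borel_on UNIV \<Psi>"
    and u: "bounded_borel_on X u"
  shows "bounded_borel_on X (obstacle_operator \<Omega> X \<alpha> \<epsilon> F \<Psi> u)"
proof -
  let ?u = "\<lambda>x. if x \<in> X then u x else 0" and ?F = "\<lambda>x. if x \<in> X - \<Omega> then F x else 0"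
  let ?T = "obstacle_operator \<Omega> X \<alpha> \<epsilon> F \<Psi> u"
  have u0: "bounded_borel_on UNIV ?u"
    using u bounded_borel_on_iff_extension[OF X] by blast
  have "X - \<Omega> \<in> sets borel" using X \<Omega>(1) by auto
  then have F0: "bounded_borel_on UNIV ?F"
    using F bounded_borel_on_iff_extension by blast
  obtain C where C: "\<And>x. \<bar>?u x\<bar> \<le> C"
    by (rule bounded_borel_on_UNIV_bound[OF u0]) (rule that)
  obtain D where D: "\<And>x. \<bar>?F x\<bar> \<le> D"
    by (rule bounded_borel_on_UNIV_bound[OF F0]) (rule that)
  obtain P where P: "\<And>x. \<bar>\<Psi> x\<bar> \<le> P"
    by (rule bounded_borel_on_UNIV_bound[OF \<Psi>]) (rule that)
  have mean: "tug_mean \<alpha> \<epsilon> u x = tug_mean \<alpha> \<epsilon> ?u x" if "x \<in> \<Omega>" for x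
    using balls[OF that] by (intro tug_mean_cong) auto
  have T: "?T x = (if x \<in> \<Omega> then max (\<Psi> x) (tug_mean \<alpha> \<epsilon> ?u x) else ?F x)" if "x \<in> X" for x
    using that mean by (simp add: obstacle_operator_def)
  have mean_bound: "\<bar>tug_mean \<alpha> \<epsilon> ?u x\<bar> \<le> C" for x
    by (rule tug_mean_bounded[OF \<alpha> \<epsilon> bounded_borel_on_subset[OF u0] C]) simp
  have "\<bar>?T x\<bar> \<le> max C (max D P)" if "x \<in> X" for x
    using T[OF that] mean_bound[of x] D[of x] P[of x] by (auto simp del: if_image_distrib split: if_splits)
  then have "bounded (?T ` X)" by (intro boundedI[of _ "max C (max D P)"]) auto
  moreover have "?T \<in> borel_measurable (restrict_space borel X)"
  proof -
    have "\<Psi> \<in> borel_measurable borel" "tug_mean \<alpha> \<epsilon> ?u \<in> borel_measurable borel"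
      using \<Psi> borel_measurable_tug_mean[OF \<epsilon> u0] by (simp_all add: bounded_borel_on_UNIV_iff)
    then have "(\<lambda>x. max (\<Psi> x) (tug_mean \<alpha> \<epsilon> ?u x)) \<in> borel_measurable borel"
      by (intro borel_measurable_max)
    moreover have "?F \<in> borel_measurable borel"
      using F0 unfolding bounded_borel_on_UNIV_iff by (rule conjunct1)
    ultimately have "(\<lambda>x. if x \<in> \<Omega> then max (\<Psi> x) (tug_mean \<alpha> \<epsilon> ?u x) else ?F x) \<in> borel_measurable borel"
      by (rule measurable_If) (use \<Omega>(1) in simp)
    then have "(\<lambda>x. if x \<in> \<Omega> then max (\<Psi> x) (tug_mean \<alpha> \<epsilon> ?u x) else ?F x)
        \<in> borel_measurable (restrict_space borel X)"
      by (rule measurable_restrict_space1)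
    then show ?thesis
      by (rule measurable_cong[THEN iffD2, rotated]) (simp add: T space_restrict_space)
  qed
  ultimately show ?thesis by (simp add: bounded_borel_on_def)
qed

text \<open>
  Taking the maximum with the obstacle is nonexpansive and the boundary values cancel in a
  difference, so the operator inherits the contraction factor of the weight.
\<close>

lemma obstacle_operator_unique_fixpoint:
  fixes \<Omega> X :: "'a::euclidean_space set"
  assumes \<Omega>: "open \<Omega>" "bounded \<Omega>" "\<Omega> \<subseteq> X" and X: "X \<in> sets borel"
    and balls: "\<And>x. x \<in> \<Omega> \<Longrightarrow> ball x \<epsilon> \<subseteq> X"
    and \<alpha>: "0 \<le> \<alpha>" "\<alpha> < 1" and \<epsilon>: "0 < \<epsilon>"
    and F: "bounded_borel_on (X - \<Omega>) F" and \<Psi>: "bounded_borel_on UNIV \<Psi>"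
  shows "\<exists>!u. (u \<in> extensional X \<and> bounded_borel_on X u) \<and> obstacle_operator \<Omega> X \<alpha> \<epsilon> F \<Psi> u = u"
proof -
  let ?V = "{u. u \<in> extensional X \<and> bounded_borel_on X u}"
  obtain \<phi> c m A where \<phi>: "bounded_borel_on UNIV \<phi>" "0 < m" "\<And>x. m \<le> \<phi> x" "\<And>x. \<phi> x \<le> A"
    and c: "0 \<le> c" "c < 1" and super: "\<And>x. x \<in> \<Omega> \<Longrightarrow> upper_mean \<alpha> \<epsilon> \<phi> x \<le> c * \<phi> x"
    by (rule strict_supersolution_exists[OF \<Omega>(2) \<alpha> \<epsilon>]) (rule that)
  have "\<exists>!u. u \<in> ?V \<and> obstacle_operator \<Omega> X \<alpha> \<epsilon> F \<Psi> u = u"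
  proof (rule weighted_contraction_unique_fixpoint[where m=m and c=c and A=A and \<phi>=\<phi> and X=X])
    have "bounded_borel_on X (\<lambda>x\<in>X. 0)"
    proof -
      have "(\<lambda>x. if x \<in> X then (\<lambda>x\<in>X. 0) x else 0) = (\<lambda>_. 0 :: real)" by auto
      moreover have "bounded_borel_on UNIV (\<lambda>_::'a. 0 :: real)"
        by (rule continuous_bounded_borel_on) auto
      ultimately show ?thesis unfolding bounded_borel_on_iff_extension[OF X] by (simp only:)
    qed
    then have "(\<lambda>x\<in>X. 0) \<in> ?V" by simp
    then show "?V \<noteq> {}" by blast
    show "obstacle_operator \<Omega> X \<alpha> \<epsilon> F \<Psi> u \<in> ?V" if "u \<in> ?V" for u
    proof -
      have "bounded_borel_on X (obstacle_operator \<Omega> X \<alpha> \<epsilon> F \<Psi> u)"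
        using that by (intro bounded_borel_on_obstacle_operator \<Omega> X balls \<alpha> less_imp_le[OF \<alpha>(2)] \<epsilon> F \<Psi>) auto
      then show ?thesis by (simp add: obstacle_operator_def)
    qed
    show "g \<in> ?V" if "\<And>n. f n \<in> ?V" "g \<in> extensional X" "uniform_limit X f g sequentially"
      for f :: "nat \<Rightarrow> 'a \<Rightarrow> real" and g
    proof -
      have "bounded_borel_on X (f n)" for n using that(1)[of n] by blast
      then have "bounded_borel_on X g" using that(3) by (rule bounded_borel_on_uniform_limit)
      then show ?thesis using that(2) by blast
    qed
    show "\<forall>x\<in>X. \<bar>obstacle_operator \<Omega> X \<alpha> \<epsilon> F \<Psi> u x - obstacle_operator \<Omega> X \<alpha> \<epsilon> F \<Psi> v x\<bar> \<le> c * K * \<phi> x"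
      if uv: "u \<in> ?V" "v \<in> ?V" and K: "0 \<le> K" and le: "\<And>x. x \<in> X \<Longrightarrow> \<bar>u x - v x\<bar> \<le> K * \<phi> x" for u v K
    proof
      fix x assume x: "x \<in> X"
      show "\<bar>obstacle_operator \<Omega> X \<alpha> \<epsilon> F \<Psi> u x - obstacle_operator \<Omega> X \<alpha> \<epsilon> F \<Psi> v x\<bar> \<le> c * K * \<phi> x"
      proof (cases "x \<in> \<Omega>")
        case True
        have "\<bar>tug_mean \<alpha> \<epsilon> u x - tug_mean \<alpha> \<epsilon> v x\<bar> \<le> K * upper_mean \<alpha> \<epsilon> \<phi> x"
        proof (rule tug_mean_abs_diff_le[OF \<alpha>(1) less_imp_le[OF \<alpha>(2)] \<epsilon> K])
          show "bounded_borel_on (ball x \<epsilon>) u" "bounded_borel_on (ball x \<epsilon>) v"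
            using uv bounded_borel_on_subset[OF _ balls[OF True]] by simp_all
          show "bounded_borel_on (ball x \<epsilon>) \<phi>"
            using \<phi>(1) by (rule bounded_borel_on_subset) simp
          show "\<bar>u y - v y\<bar> \<le> K * \<phi> y" if "y \<in> ball x \<epsilon>" for y
            using balls[OF True] that by (intro le) blast
        qed
        also have "\<dots> \<le> K * (c * \<phi> x)" using super[OF True] K by (rule mult_left_mono)
        finally show ?thesis using x True by (simp add: obstacle_operator_def mult_ac)
      next
        case False
        have "0 \<le> \<phi> x" using \<phi>(2,3) by (meson less_imp_le order_trans)
        then show ?thesis using x False c K by (simp add: obstacle_operator_def)
      qed
    qed
    show "?V \<subseteq> extensional X" by blast
    show "bounded (u ` X)" if "u \<in> ?V" for u using that by (simp add: bounded_borel_on_def)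
  qed (rule \<phi> c)+
  then show ?thesis by (simp only: mem_Collect_eq)
qed

theorem theorem1p1:
  fixes \<Omega> \<Gamma> X :: "(real ^ 'n) set"
    and \<epsilon>0 \<epsilon> \<alpha> \<beta> :: real
    and F \<Psi> :: "real ^ 'n \<Rightarrow> real"
  assumes "open \<Omega>" and "bounded \<Omega>" and "lipschitz_boundary \<Omega>"
    and "0 < \<epsilon>0" and "\<epsilon>0 < 1"
    and "\<Gamma> = outer_strip \<Omega> \<epsilon>0" and "X = \<Omega> \<union> \<Gamma>"
    and "0 < \<epsilon>" and "\<epsilon> \<le> \<epsilon>0"
    and "0 \<le> \<alpha>" and "\<alpha> < 1" and "\<beta> = 1 - \<alpha>"
    and "bounded_borel_on (closure \<Gamma>) F"
    and "bounded_borel_on UNIV \<Psi>"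
    and "\<forall>x \<in> closure \<Gamma>. \<Psi> x \<le> F x"
  shows "\<exists>!u. u \<in> extensional X \<and> bounded_borel_on X u \<and>
      (\<forall>x \<in> \<Omega>. u x = max (\<Psi> x)
          (\<alpha> / 2 * (SUP y \<in> ball x \<epsilon>. u y) + \<alpha> / 2 * (INF y \<in> ball x \<epsilon>. u y)
             + \<beta> * ball_average \<epsilon> u x)) \<and>
      (\<forall>x \<in> \<Gamma>. u x = F x)"
proof -
  have X_eq: "X = \<Omega> \<union> {x. infdist x \<Omega> < \<epsilon>0}" and strip: "X - \<Omega> = \<Gamma>"
    using assms(6,7) by (auto simp: outer_strip_def)
  have "open {x. infdist x \<Omega> < \<epsilon>0}"
    by (intro open_Collect_less continuous_intros)
  then have X: "X \<in> sets borel" using assms(1) by (auto simp: X_eq)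
  have balls: "ball x \<epsilon> \<subseteq> X" if "x \<in> \<Omega>" for x
  proof
    fix y assume "y \<in> ball x \<epsilon>"
    then have "infdist y \<Omega> < \<epsilon>0"
      using infdist_le[OF that, of y] assms(9) by (auto simp: dist_commute)
    then show "y \<in> X" by (simp add: X_eq)
  qed
  have F: "bounded_borel_on (X - \<Omega>) F"
    unfolding strip by (rule bounded_borel_on_subset[OF assms(13) closure_subset])
  have unique: "\<exists>!u. (u \<in> extensional X \<and> bounded_borel_on X u) \<and> obstacle_operator \<Omega> X \<alpha> \<epsilon> F \<Psi> u = u"
  proof (rule obstacle_operator_unique_fixpoint[OF assms(1,2) _ X balls assms(10,11,8) F assms(14)])
    show "\<Omega> \<subseteq> X" by (simp add: X_eq)
  qed
  have "((u \<in> extensional X \<and> bounded_borel_on X u) \<and> obstacle_operator \<Omega> X \<alpha> \<epsilon> F \<Psi> u = u) \<longleftrightarrow>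
      (u \<in> extensional X \<and> bounded_borel_on X u \<and>
       (\<forall>x \<in> \<Omega>. u x = max (\<Psi> x) (tug_mean \<alpha> \<epsilon> u x)) \<and> (\<forall>x \<in> \<Gamma>. u x = F x))" for u
  proof (cases "u \<in> extensional X")
    case True
    then have "(obstacle_operator \<Omega> X \<alpha> \<epsilon> F \<Psi> u = u) \<longleftrightarrow>
        (\<forall>x\<in>X. u x = (if x \<in> \<Omega> then max (\<Psi> x) (tug_mean \<alpha> \<epsilon> u x) else F x))"
      by (auto simp: obstacle_operator_def fun_eq_iff extensional_def restrict_def)
    also have "\<dots> \<longleftrightarrow> (\<forall>x \<in> \<Omega>. u x = max (\<Psi> x) (tug_mean \<alpha> \<epsilon> u x)) \<and> (\<forall>x \<in> \<Gamma>. u x = F x)"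
      unfolding strip[symmetric] using assms(7) by auto
    finally show ?thesis using True by simp
  qed simp
  then show ?thesis
    using unique unfolding tug_mean_def assms(12) by (simp only:)
qed

end
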